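(* Let $(A,B)$ be a Katsura pair with $B\in M_N(\{0,1\})$ such that the KEP-action $(G_B,E_A)$ is regular. Then there is a continuous injection $\zeta:\mathcal{J}_{G_B,E_A}\to\mathbb{C}$.
   Context: Katsura pair: $N\in\mathbb{N}$, $A\in M_N(\mathbb{N})$ (nonnegative integers), $B\in M_N(\mathbb{Z})$ with $A_{ij}=0\Rightarrow B_{ij}=0$. Graph $E_A$: vertices $\{1,\dots,N\}$, edges $e_{i,j,m}$ ($0\le m<A_{ij}$) with $r=i$, $s=j$; finite paths $\mu_1\cdots\mu_n$ with $s(\mu_i)=r(\mu_{i+1})$; $E_A^{-\infty}$ left-infinite paths $\cdots\mu_{-2}\mu_{-1}$ with product topology, shift $\sigma$ deleting $\mu_{-1}$. The group bundle $\mathbb{Z}\times E_A^0$ (elements $a_i^k$) acts by $a_i^k\cdot e_{i,j,m}=e_{i,j,\hat m}$, $a_i^k|_{e_{i,j,m}}=a_j^{\hat k}$ with $kB_{ij}+m=\hat kA_{ij}+\hat m$, $0\le\hat m<A_{ij}$, extended recursively to paths by $g\cdot(e\nu)=(g\cdot e)(g|_e\cdot\nu)$; $G_B$ is the quotient by the elements acting trivially, and $(G_B,E_A)$ is the KEP-action. Regular: for every $g\in G_B$ there is $K$ such that $g\cdot\mu=\mu$, $|\mu|\ge K$ imply $g|_\mu$ is the unit at $s(\mu)$. Limit space: $\mu\sim_{ae}\nu$ iff there are a finite $F\subseteq G_B$ and $(g_n)_{n<0}\subseteq F$ with $d(g_n)=r(\mu_n)$ and $g_n\cdot\mu_n\cdots\mu_{-1}=\nu_n\cdots\nu_{-1}$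 for all $n<0$; $\mathcal{J}_{G_B,E_A}=E_A^{-\infty}/\sim_{ae}$ with quotient topology. *)

theory Defs
  imports "HOL-Analysis.Analysis"
begin

text \<open>Katsura pairs and the KEP-action.  Vertices are 1..N; the edge e_{i,j,m}
  is the triple (i,j,m), with range r = i and source s = j.  A finite path
  mu_1 ... mu_n is the list [mu_1, ..., mu_n].\<close>

type_synonym edge = "nat \<times> nat \<times> nat"

definition katsura_pair :: "nat \<Rightarrow> (nat \<Rightarrow> nat \<Rightarrow> nat) \<Rightarrow> (nat \<Rightarrow> nat \<Rightarrow> int) \<Rightarrow> bool" where
  "katsura_pair N A B \<longleftrightarrow> (\<forall>i\<in>{1..N}. \<forall>j\<in>{1..N}. A i j = 0 \<longrightarrow> B i j = 0)"

definition edges :: "nat \<Rightarrow> (nat \<Rightarrow> nat \<Rightarrow> nat) \<Rightarrow> edge set" where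
  "edges N A = {(i,j,m). i \<in> {1..N} \<and> j \<in> {1..N} \<and> m < A i j}"

definition rng :: "edge \<Rightarrow> nat" where "rng e = fst e"
definition src :: "edge \<Rightarrow> nat" where "src e = fst (snd e)"

definition fpath :: "nat \<Rightarrow> (nat \<Rightarrow> nat \<Rightarrow> nat) \<Rightarrow> nat \<Rightarrow> edge list \<Rightarrow> bool" where
  "fpath N A i \<mu> \<longleftrightarrow> i \<in> {1..N} \<and> set \<mu> \<subseteq> edges N A \<and>
     (\<mu> \<noteq> [] \<longrightarrow> rng (hd \<mu>) = i) \<and>
     (\<forall>t. Suc t < length \<mu> \<longrightarrow> src (\<mu> ! t) = rng (\<mu> ! Suc t))"

definition psrc :: "nat \<Rightarrow> edge list \<Rightarrow> nat" where
  "psrc i \<mu> = (if \<mu> = [] then i else src (last \<mu>))"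

text \<open>Action of a_i^k on an edge e_{i,j,m}: k B_ij + m = khat A_ij + mhat.
  Extended recursively: g.(e nu) = (g.e)(g|_e . nu).\<close>
fun pact :: "(nat \<Rightarrow> nat \<Rightarrow> nat) \<Rightarrow> (nat \<Rightarrow> nat \<Rightarrow> int) \<Rightarrow> int \<Rightarrow> edge list \<Rightarrow> edge list" where
  "pact A B k [] = []"
| "pact A B k ((i,j,m) # \<nu>) =
     (i, j, nat ((k * B i j + int m) mod int (A i j)))
       # pact A B ((k * B i j + int m) div int (A i j)) \<nu>"

text \<open>restriction a_i^k|_mu = a_{s(mu)}^{k'}; this gives k'\<close>
fun prestr :: "(nat \<Rightarrow> nat \<Rightarrow> nat) \<Rightarrow> (nat \<Rightarrow> nat \<Rightarrow> int) \<Rightarrow> int \<Rightarrow> edge list \<Rightarrow> int" where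
  "prestr A B k [] = k"
| "prestr A B k ((i,j,m) # \<nu>) = prestr A B ((k * B i j + int m) div int (A i j)) \<nu>"

text \<open>group bundle Z x E^0: a_i^k is the pair (i,k)\<close>
definition zbundle :: "nat \<Rightarrow> (nat \<times> int) set" where
  "zbundle N = {1..N} \<times> UNIV"

definition kerrel :: "nat \<Rightarrow> (nat \<Rightarrow> nat \<Rightarrow> nat) \<Rightarrow> (nat \<Rightarrow> nat \<Rightarrow> int) \<Rightarrow> ((nat \<times> int) \<times> (nat \<times> int)) set" where
  "kerrel N A B = {((i,k),(i',k')). i \<in> {1..N} \<and> i' = i \<and>
      (\<forall>\<mu>. fpath N A i \<mu> \<longrightarrow> pact A B (k - k') \<mu> = \<mu>)}"

definition GB :: "nat \<Rightarrow> (nat \<Rightarrow> nat \<Rightarrow> nat) \<Rightarrow> (nat \<Rightarrow> nat \<Rightarrow> int) \<Rightarrow> (nat \<times> int) set set" where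
  "GB N A B = zbundle N // kerrel N A B"

definition gcls :: "nat \<Rightarrow> (nat \<Rightarrow> nat \<Rightarrow> nat) \<Rightarrow> (nat \<Rightarrow> nat \<Rightarrow> int) \<Rightarrow> nat \<times> int \<Rightarrow> (nat \<times> int) set" where
  "gcls N A B p = kerrel N A B `` {p}"

definition gdom :: "(nat \<times> int) set \<Rightarrow> nat" where
  "gdom g = fst (SOME p. p \<in> g)"

definition gact :: "(nat \<Rightarrow> nat \<Rightarrow> nat) \<Rightarrow> (nat \<Rightarrow> nat \<Rightarrow> int) \<Rightarrow> (nat \<times> int) set \<Rightarrow> edge list \<Rightarrow> edge list" where
  "gact A B g \<mu> = pact A B (snd (SOME p. p \<in> g)) \<mu>"

definition grestr :: "nat \<Rightarrow> (nat \<Rightarrow> nat \<Rightarrow> nat) \<Rightarrow> (nat \<Rightarrow> nat \<Rightarrow> int) \<Rightarrow> (nat \<times> int) set \<Rightarrow> edge list \<Rightarrow> (nat \<times> int) set" where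
  "grestr N A B g \<mu> = gcls N A B (psrc (gdom g) \<mu>, prestr A B (snd (SOME p. p \<in> g)) \<mu>)"

definition gunit :: "nat \<Rightarrow> (nat \<Rightarrow> nat \<Rightarrow> nat) \<Rightarrow> (nat \<Rightarrow> nat \<Rightarrow> int) \<Rightarrow> nat \<Rightarrow> (nat \<times> int) set" where
  "gunit N A B v = gcls N A B (v, 0)"

definition regular :: "nat \<Rightarrow> (nat \<Rightarrow> nat \<Rightarrow> nat) \<Rightarrow> (nat \<Rightarrow> nat \<Rightarrow> int) \<Rightarrow> bool" where
  "regular N A B \<longleftrightarrow> (\<forall>g \<in> GB N A B. \<exists>K::nat. \<forall>\<mu>.
     fpath N A (gdom g) \<mu> \<and> gact A B g \<mu> = \<mu> \<and> length \<mu> \<ge> K \<longrightarrow>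
       grestr N A B g \<mu> = gunit N A B (psrc (gdom g) \<mu>))"

text \<open>Left-infinite paths ... mu_{-2} mu_{-1}: x t represents mu_{-(t+1)}.\<close>
definition infpaths :: "nat \<Rightarrow> (nat \<Rightarrow> nat \<Rightarrow> nat) \<Rightarrow> (nat \<Rightarrow> edge) set" where
  "infpaths N A = {x. (\<forall>t. x t \<in> edges N A) \<and> (\<forall>t. src (x (Suc t)) = rng (x t))}"

definition inftop :: "nat \<Rightarrow> (nat \<Rightarrow> nat \<Rightarrow> nat) \<Rightarrow> (nat \<Rightarrow> edge) topology" where
  "inftop N A = subtopology (product_topology (\<lambda>_. discrete_topology (edges N A)) UNIV) (infpaths N A)"

text \<open>the finite tail mu_n ... mu_{-1} with n = -(t+1)\<close>
definition tailp :: "(nat \<Rightarrow> edge) \<Rightarrow> nat \<Rightarrow> edge list" where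
  "tailp x t = rev (map x [0..<Suc t])"

definition ae_rel :: "nat \<Rightarrow> (nat \<Rightarrow> nat \<Rightarrow> nat) \<Rightarrow> (nat \<Rightarrow> nat \<Rightarrow> int) \<Rightarrow> ((nat \<Rightarrow> edge) \<times> (nat \<Rightarrow> edge)) set" where
  "ae_rel N A B = {(x,y). x \<in> infpaths N A \<and> y \<in> infpaths N A \<and>
     (\<exists>F. F \<subseteq> GB N A B \<and> finite F \<and> (\<exists>g :: nat \<Rightarrow> (nat \<times> int) set.
        \<forall>t. g t \<in> F \<and> gdom (g t) = rng (x t) \<and> gact A B (g t) (tailp x t) = tailp y t))}"

definition limit_space :: "nat \<Rightarrow> (nat \<Rightarrow> nat \<Rightarrow> nat) \<Rightarrow> (nat \<Rightarrow> nat \<Rightarrow> int) \<Rightarrow> (nat \<Rightarrow> edge) set set" where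
  "limit_space N A B = infpaths N A // ae_rel N A B"

definition limit_top :: "nat \<Rightarrow> (nat \<Rightarrow> nat \<Rightarrow> nat) \<Rightarrow> (nat \<Rightarrow> nat \<Rightarrow> int) \<Rightarrow> (nat \<Rightarrow> edge) set topology" where
  "limit_top N A B = topology (\<lambda>U. U \<subseteq> limit_space N A B \<and>
      openin (inftop N A) {x \<in> infpaths N A. ae_rel N A B `` {x} \<in> U})"

end

theory Submission
  imports Defs
begin

text \<open>
  Along a run of edges with \<open>B i j = 1\<close> the action is an odometer, so the digits of the run, read as
  a mixed-radix fraction, are determined up to asymptotic equivalence modulo integers; an edge with
  \<open>B i j = 0\<close> absorbs every carry. Hence a fibre of the limit space over a vertex sequence consists of
  circles and points. They are placed in the plane by an iterated function system on the unit square: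
  an edge with \<open>B i j = 1\<close> divides the horizontal coordinate by \<open>A i j\<close> and picks a horizontal strip,
  while an edge with \<open>B i j = 0\<close> wraps the square around an annulus, which glues its vertical sides, and
  puts a small copy of the annulus into the interior of the square. A path determines the point in
  the intersection of the nested squares, and wrapping the outermost square around an annulus makes
  two paths collide exactly when their carries stay bounded, that is, when they are asymptotically
  equivalent. Regularity guarantees that the nested squares shrink to a point.
\<close>

section \<open>Wrapping the unit square around an annulus\<close>

text \<open>The square goes to the annulus of radii 1 and 2, with the real part as angle in full
  turns. The positive inner radius keeps the angle recoverable.\<close>

definition polar :: "complex \<Rightarrow> complex" where
  "polar z = of_real (1 + Im z) * cis (2 * pi * Re z)"

definition unit_square :: "complex set" where
  "unit_square = {z. 0 \<le> Re z \<and> Re z \<le> 1 \<and> 0 \<le> Im z \<and> Im z \<le> 1}"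

text \<open>Since \<open>polar\<close> is 1-periodic in the real part, points whose real parts differ by an integer
  \<open>k\<close> (the carry) count as close; \<open>k\<close> is kept explicit because it changes along a path.\<close>

definition twist_dist :: "complex \<Rightarrow> complex \<Rightarrow> int \<Rightarrow> real" where
  "twist_dist z w k = \<bar>Re w - Re z + of_int k\<bar> + \<bar>Im w - Im z\<bar>"

lemma norm_cis_diff_le: "norm (cis a - cis b) \<le> \<bar>a - b\<bar>"
proof -
  have "cis a - cis b = cis b * (exp (\<i> * of_real (a - b)) - 1)"
    by (simp add: cis_conv_exp exp_diff algebra_simps)
  then have "norm (cis a - cis b) = 2 * \<bar>sin ((a - b) / 2)\<bar>"
    by (simp only: norm_mult norm_cis dist_exp_i_1 mult_1)
  also have "\<dots> \<le> 2 * \<bar>(a - b) / 2\<bar>"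
    by (intro mult_left_mono abs_sin_x_le_abs_x) auto
  finally show ?thesis by simp
qed

lemma cis_add_of_int: "cis (2 * pi * (a + of_int k)) = cis (2 * pi * a)"
proof -
  have "cis (2 * pi * (a + of_int k)) = cis (2 * pi * a) * cis (2 * pi * of_int k)"
    by (simp only: cis_mult distrib_left)
  then show ?thesis by simp
qed

lemma cis_eq_imp_Ints:
  assumes "cis (2 * pi * a) = cis (2 * pi * b)"
  shows "\<exists>k::int. a - b = of_int k"
proof -
  obtain n :: int where "\<i> * of_real (2 * pi * a) = \<i> * of_real (2 * pi * b) + (of_int (2 * n) * pi) * \<i>"
    using assms unfolding cis_conv_exp exp_eq by blast
  then have "Im (\<i> * of_real (2 * pi * a)) = Im (\<i> * of_real (2 * pi * b) + (of_int (2 * n) * pi) * \<i>)"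
    by simp
  then have "a * pi = (b + of_int n) * pi"
    by (simp add: algebra_simps)
  then have "a - b = of_int n" by simp
  then show ?thesis by blast
qed

lemma norm_polar: "norm (polar z) = \<bar>1 + Im z\<bar>"
  unfolding polar_def by (simp only: norm_mult norm_of_real norm_cis mult_1_right)

lemma norm_polar_le: "z \<in> unit_square \<Longrightarrow> norm (polar z) \<le> 2"
  by (simp add: norm_polar unit_square_def)

text \<open>Any integer \<open>k\<close> is allowed because \<open>polar\<close> has period 1 in the
  real part. The radius is at most 2 and the angle moves at speed \<open>2 * pi\<close>, so 16 comes
  from \<open>4 * pi < 16\<close>.\<close>

lemma norm_polar_diff_le:
  assumes "z \<in> unit_square" "w \<in> unit_square"
  shows "norm (polar w - polar z) \<le> 16 * twist_dist z w k"
proof -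
  have "polar w - polar z = of_real (1 + Im w) * (cis (2 * pi * (Re w + of_int k)) - cis (2 * pi * Re z))
      + of_real (Im w - Im z) * cis (2 * pi * Re z)"
    unfolding cis_add_of_int polar_def by (simp add: algebra_simps)
  then have "norm (polar w - polar z) \<le>
      norm (of_real (1 + Im w) * (cis (2 * pi * (Re w + of_int k)) - cis (2 * pi * Re z)))
      + norm (of_real (Im w - Im z) * cis (2 * pi * Re z))"
    by (simp only: norm_triangle_ineq)
  then have "norm (polar w - polar z) \<le>
      \<bar>1 + Im w\<bar> * norm (cis (2 * pi * (Re w + of_int k)) - cis (2 * pi * Re z)) + \<bar>Im w - Im z\<bar>"
    by (simp only: norm_mult norm_of_real norm_cis mult_1_right)
  also have "\<dots> \<le> 2 * \<bar>2 * pi * (Re w + of_int k) - 2 * pi * Re z\<bar> + \<bar>Im w - Im z\<bar>"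
    using assms norm_cis_diff_le by (intro add_right_mono mult_mono) (auto simp: unit_square_def)
  finally have 1: "norm (polar w - polar z) \<le>
      2 * \<bar>2 * pi * (Re w + of_int k) - 2 * pi * Re z\<bar> + \<bar>Im w - Im z\<bar>" .
  have "2 * pi * (Re w + of_int k) - 2 * pi * Re z = 2 * pi * (Re w - Re z + of_int k)"
    by (simp add: algebra_simps)
  then have "2 * \<bar>2 * pi * (Re w + of_int k) - 2 * pi * Re z\<bar> = (4 * pi) * \<bar>Re w - Re z + of_int k\<bar>"
    by (simp only: abs_mult) simp
  also have "\<dots> \<le> 16 * \<bar>Re w - Re z + of_int k\<bar>"
    using pi_less_4 by (intro mult_right_mono) auto
  finally have "norm (polar w - polar z) \<le> 16 * \<bar>Re w - Re z + of_int k\<bar> + \<bar>Im w - Im z\<bar>"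
    using 1 by linarith
  also have "\<dots> \<le> 16 * twist_dist z w k"
    by (simp add: twist_dist_def)
  finally show ?thesis .
qed

text \<open>The modulus gives back the imaginary part; dividing by this nonzero radius leaves the
  angle, known up to full turns.\<close>

lemma polar_eq_imp:
  assumes "polar z = polar w" "z \<in> unit_square" "w \<in> unit_square"
  shows "Im z = Im w \<and> (\<exists>k::int. Re w = Re z - of_int k)"
proof -
  have "norm (polar z) = norm (polar w)" using assms by simp
  then have im: "Im z = Im w" using assms(2,3) by (simp add: norm_polar unit_square_def)
  have "1 + Im w \<noteq> 0" using assms by (simp add: unit_square_def)
  then have "cis (2 * pi * Re z) = cis (2 * pi * Re w)"
    using assms(1) im unfolding polar_def by (simp del: of_real_add)
  then show ?thesis using cis_eq_imp_Ints[of "Re z" "Re w"] im by (auto simp: algebra_simps)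
qed

lemma closed_unit_square: "closed unit_square"
  unfolding unit_square_def
  by (intro closed_Collect_conj closed_Collect_le continuous_intros)

lemma twist_dist_unit_square:
  "z \<in> unit_square \<Longrightarrow> w \<in> unit_square \<Longrightarrow> twist_dist z w k \<le> 2 + \<bar>of_int k\<bar>"
  unfolding unit_square_def twist_dist_def by auto

lemma norm_le_twist_dist: "norm (w - z) \<le> twist_dist z w 0"
  unfolding twist_dist_def using cmod_le[of "w - z"] by simp

lemma twist_dist_le_norm: "twist_dist z w 0 \<le> 2 * norm (w - z)"
  using abs_Re_le_cmod[of "w - z"] abs_Im_le_cmod[of "w - z"] by (simp add: twist_dist_def)

section \<open>A single edge: contraction and recovery of carries\<close>

text \<open>\<open>carry A b k e e' l\<close>: the group element with exponent \<open>k\<close> maps the edge \<open>e\<close> to \<open>e'\<close> with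
  restriction of exponent \<open>l\<close>.\<close>

definition carry :: "(nat \<Rightarrow> nat \<Rightarrow> nat) \<Rightarrow> (nat \<Rightarrow> nat \<Rightarrow> bool) \<Rightarrow> int \<Rightarrow> edge \<Rightarrow> edge \<Rightarrow> int \<Rightarrow> bool" where
  "carry A b k e e' l \<longleftrightarrow> (\<exists>i j m m'. e = (i,j,m) \<and> e' = (i,j,m') \<and>
     k * of_bool (b i j) + int m = l * int (A i j) + int m')"

text \<open>\<open>c\<close> numbers horizontal strips of height \<open>1 / M\<close>, and
  \<open>b\<close> marks the edges that pass carries on. The final theorem takes
  \<open>moving\<close> for \<open>b\<close>, a modification of \<open>B\<close>.\<close>

locale edge_coding =
  fixes N :: nat and A :: "nat \<Rightarrow> nat \<Rightarrow> nat" and b :: "nat \<Rightarrow> nat \<Rightarrow> bool"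
    and c :: "edge \<Rightarrow> nat" and M :: nat
  assumes c_inj: "inj_on c (edges N A)"
    and c_less: "e \<in> edges N A \<Longrightarrow> c e < M"
begin

text \<open>The horizontal strips containing the pieces of two edges agree exactly when the edges have the
  same vertices and, on edges where the odometer stops, the same digit.\<close>

definition strip :: "edge \<Rightarrow> edge" where
  "strip e = (case e of (i,j,m) \<Rightarrow> if b i j then (i,j,0) else e)"

text \<open>Only the lower half of a strip is used, so images in different strips stay apart. The
  annulus is centred in that half; its scale keeps it off the vertical sides of the square and makes
  the map contract.\<close>

definition piece :: "edge \<Rightarrow> complex \<Rightarrow> complex" where
  "piece e z = (case e of (i,j,m) \<Rightarrow>
     if b i j then Complex ((real m + Re z) / real (A i j)) ((2 * real (c (strip e)) + Im z) / (2 * real M))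
     else Complex (1 / 2) ((2 * real (c (strip e)) + 1 / 2) / (2 * real M)) + polar z / of_real (64 * real M))"

definition rigid :: "edge \<Rightarrow> bool" where
  "rigid e = (case e of (i,j,m) \<Rightarrow> b i j \<and> A i j = 1)"

text \<open>Bound for the Lipschitz factor of \<open>piece\<close> with respect to
  \<open>twist_dist\<close>: a rigid edge leaves horizontal distances unchanged, any other edge at
  least halves them.\<close>

definition rate :: "edge \<Rightarrow> real" where
  "rate e = (if rigid e then 1 else 1 / 2)"

lemma strip_edge: "e \<in> edges N A \<Longrightarrow> strip e \<in> edges N A"
  by (auto simp: strip_def edges_def split: if_splits)

lemma M_pos: "e \<in> edges N A \<Longrightarrow> 0 < M"
  using c_less by fastforce

text \<open>The free upper half of each strip separates the strips, so equal imaginary parts force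
  equal strip numbers in \<open>piece_carry\<close>.\<close>

lemma piece_Im:
  assumes "e \<in> edges N A" "z \<in> unit_square"
  shows "real (c (strip e)) \<le> real M * Im (piece e z)"
    and "real M * Im (piece e z) \<le> real (c (strip e)) + 1 / 2"
proof -
  obtain i j m where e: "e = (i,j,m)" by (cases e)
  have M: "0 < real M" using M_pos assms by simp
  have "\<bar>Im (polar z)\<bar> \<le> 2" using norm_polar_le[OF assms(2)] abs_Im_le_cmod order_trans by blast
  \<comment> \<open>The annulus is centred a quarter of a strip above the lower boundary, which is
    the offset 16/64.\<close>
  then have "0 \<le> 16 + Im (polar z)" "Im (polar z) \<le> 16" by auto
  moreover have "real M * Im (piece e z) =
      real (c (strip e)) + (if b i j then Im z / 2 else (16 + Im (polar z)) / 64)"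
    using M by (simp add: piece_def e field_simps)
  ultimately show "real (c (strip e)) \<le> real M * Im (piece e z)"
    and "real M * Im (piece e z) \<le> real (c (strip e)) + 1 / 2"
    using assms(2) by (auto simp: unit_square_def)
qed

text \<open>Two points of the middle half never differ by a nonzero integer, so no carry can leave
  such an edge.\<close>

lemma piece_Re:
  assumes "(i,j,m) \<in> edges N A" "z \<in> unit_square" "\<not> b i j"
  shows "1 / 4 \<le> Re (piece (i,j,m) z)" "Re (piece (i,j,m) z) \<le> 3 / 4"
proof -
  have M: "1 \<le> real M" using M_pos assms by fastforce
  have "\<bar>Re (polar z)\<bar> \<le> 2" using norm_polar_le[OF assms(2)] abs_Re_le_cmod order_trans by blast
  moreover have "\<bar>Re (polar z) / (64 * real M)\<bar> \<le> \<bar>Re (polar z)\<bar>  / 64"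
    unfolding abs_divide using M by (intro divide_left_mono) auto
  ultimately have "\<bar>Re (polar z) / (64 * real M)\<bar> \<le> 1 / 4" by linarith
  moreover have "Re (piece (i,j,m) z) = 1 / 2 + Re (polar z) / (64 * real M)"
    using assms(3) by (simp add: piece_def del: of_real_mult)
  ultimately show "1 / 4 \<le> Re (piece (i,j,m) z)" "Re (piece (i,j,m) z) \<le> 3 / 4"
    by linarith+
qed

lemma piece_unit_square:
  assumes "e \<in> edges N A" "z \<in> unit_square"
  shows "piece e z \<in> unit_square"
proof -
  obtain i j m where e: "e = (i,j,m)" by (cases e)
  have M: "0 < real M" using M_pos assms by simp
  have "c (strip e) < M" using c_less strip_edge assms by blast
  then have cM: "real (c (strip e)) + 1 \<le> real M" by linarith
  have "0 \<le> real M * Im (piece e z)" "real M * Im (piece e z) \<le> real M * 1"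
    using piece_Im[OF assms] cM by linarith+
  then have im: "0 \<le> Im (piece e z)" "Im (piece e z) \<le> 1"
    using M by (auto dest: mult_left_le_imp_le simp: zero_le_mult_iff)
  have re: "0 \<le> Re (piece e z) \<and> Re (piece e z) \<le> 1"
  proof (cases "b i j")
    case True
    have "m + 1 \<le> A i j" using assms e by (auto simp: edges_def)
    then have "real m + 1 \<le> real (A i j)" by linarith
    then show ?thesis using assms(2) True by (auto simp: piece_def e unit_square_def divide_le_eq_1)
  next
    case False
    then show ?thesis using piece_Re[of i j m z] assms e by fastforce
  qed
  show ?thesis using im re by (simp add: unit_square_def)
qed

text \<open>If \<open>b i j\<close> holds, the carry equation says
  \<open>k = m' - m + l * A i j\<close>, so division by \<open>A i j\<close> turns the twist
  \<open>k\<close> into the twist \<open>l\<close>. Otherwise both digits lie below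
  \<open>A i j\<close>, which forces \<open>l = 0\<close> and \<open>m = m'\<close>, and
  \<open>polar\<close> absorbs \<open>k\<close>.\<close>

lemma piece_twist_dist:
  assumes "e \<in> edges N A" "e' \<in> edges N A" "z \<in> unit_square" "w \<in> unit_square"
    and "carry A b k e e' l"
  shows "twist_dist (piece e z) (piece e' w) l \<le> rate e * twist_dist z w k"
proof -
  obtain i j m m' where e: "e = (i,j,m)" "e' = (i,j,m')"
    and k: "k * of_bool (b i j) + int m = l * int (A i j) + int m'"
    using assms(5) unfolding carry_def by blast
  have M: "1 \<le> real M" using M_pos assms by fastforce
  have m: "m < A i j" "m' < A i j" using assms e by (auto simp: edges_def)
  show ?thesis
  proof (cases "b i j")
    case True
    have Apos: "1 \<le> real (A i j)" using m by linarith
    have "of_int (k + int m) = (of_int (l * int (A i j) + int m') :: real)" using k True by simp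
    then have km: "of_int l * real (A i j) = of_int k + real m - real m'" by simp
    have "Re (piece e' w) - Re (piece e z) + of_int l
        = (real m' + Re w - real m - Re z + of_int l * real (A i j)) / real (A i j)"
      using True Apos by (simp add: piece_def e add_divide_distrib diff_divide_distrib)
    also have "\<dots> = (Re w - Re z + of_int k) / real (A i j)" using km by simp
    finally have 1: "\<bar>Re (piece e' w) - Re (piece e z) + of_int l\<bar> = \<bar>Re w - Re z + of_int k\<bar> / real (A i j)"
      by simp
    have "Im (piece e' w) - Im (piece e z) = (Im w - Im z) / (2 * real M)"
      using True by (simp add: piece_def e strip_def add_divide_distrib diff_divide_distrib)
    then have "\<bar>Im (piece e' w) - Im (piece e z)\<bar> = \<bar>Im w - Im z\<bar> / (2 * real M)"
      by (simp add: abs_divide)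
    also have "\<dots> \<le> \<bar>Im w - Im z\<bar> / 2"
      using M by (intro divide_left_mono) auto
    finally have 2: "\<bar>Im (piece e' w) - Im (piece e z)\<bar> \<le> \<bar>Im w - Im z\<bar> / 2" .
    have "\<bar>Re w - Re z + of_int k\<bar> / real (A i j) \<le> rate e * \<bar>Re w - Re z + of_int k\<bar>"
    proof (cases "A i j = 1")
      case True
      then show ?thesis using \<open>b i j\<close> by (simp add: rate_def rigid_def e)
    next
      case False
      then have "2 \<le> real (A i j)" using m by linarith
      then have "\<bar>Re w - Re z + of_int k\<bar> / real (A i j) \<le> \<bar>Re w - Re z + of_int k\<bar> / 2"
        by (intro divide_left_mono) auto
      then show ?thesis using False by (simp add: rate_def rigid_def e)
    qed
    moreover have "\<bar>Im w - Im z\<bar> / 2 \<le> rate e * \<bar>Im w - Im z\<bar>" by (simp add: rate_def)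
    ultimately show ?thesis using 1 2 unfolding twist_dist_def distrib_left by linarith
  next
    case False
    then have "int m = l * int (A i j) + int m'" using k by simp
    then have "l * int (A i j) = int m - int m'" by simp
    then have "\<bar>l\<bar> * int (A i j) = \<bar>int m - int m'\<bar>" by (metis abs_mult abs_of_nat)
    then have "\<bar>l\<bar> * int (A i j) < 1 * int (A i j)" using m by linarith
    then have "\<bar>l\<bar> < 1" by (rule mult_right_less_imp_less) simp
    then have l: "l = 0" by simp
    then have mm: "m = m'" using \<open>int m = l * int (A i j) + int m'\<close> by simp
    have d: "piece e' w - piece e z = (polar w - polar z) / of_real (64 * real M)"
      using False by (simp add: piece_def e mm diff_divide_distrib)
    have "twist_dist (piece e z) (piece e' w) l = \<bar>Re (piece e' w - piece e z)\<bar> + \<bar>Im (piece e' w - piece e z)\<bar>"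
      by (simp add: twist_dist_def l)
    also have "\<dots> \<le> 2 * norm (piece e' w - piece e z)"
      using abs_Re_le_cmod[of "piece e' w - piece e z"] abs_Im_le_cmod[of "piece e' w - piece e z"] by linarith
    also have "\<dots> = norm (polar w - polar z) / (32 * real M)"
      unfolding d norm_divide by simp
    also have "\<dots> \<le> norm (polar w - polar z) / 32"
      using M by (intro divide_left_mono) auto
    \<comment> \<open>The scale 64 is chosen for this: the factor 2 for the sum of coordinates and
      16 for \<open>polar\<close> leave 1/2.\<close>
    also have "\<dots> \<le> 16 * twist_dist z w k / 32"
      using norm_polar_diff_le[OF assms(3,4)] by (intro divide_right_mono) auto
    finally show ?thesis using False by (simp add: rate_def rigid_def e)
  qed
qed

text \<open>Equal imaginary parts give equal strips, hence the same vertices. If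
  \<open>b i j\<close> holds, multiplying by \<open>A i j\<close> exposes the incoming carry;
  otherwise \<open>piece_Re\<close> forces \<open>l = 0\<close> and the carry is the ambiguity of
  \<open>polar\<close>.\<close>

lemma piece_carry:
  assumes "e \<in> edges N A" "e' \<in> edges N A" "z \<in> unit_square" "w \<in> unit_square"
    and im: "Im (piece e z) = Im (piece e' w)"
    and re: "Re (piece e' w) = Re (piece e z) - of_int l"
  shows "Im z = Im w \<and> (\<exists>k. Re w = Re z - of_int k \<and> carry A b k e e' l)"
proof -
  have M: "1 \<le> real M" using M_pos assms by fastforce
  have "real (c (strip e)) \<le> real (c (strip e')) + 1 / 2" "real (c (strip e')) \<le> real (c (strip e)) + 1 / 2"
    using piece_Im[OF assms(1,3)] piece_Im[OF assms(2,4)] unfolding im by linarith+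
  then have "c (strip e) = c (strip e')" by linarith
  then have strip: "strip e = strip e'"
    using c_inj strip_edge assms by (meson inj_onD)
  obtain i j m where e: "e = (i,j,m)" by (cases e)
  obtain m' where e': "e' = (i,j,m')"
    using strip by (cases e') (auto simp: strip_def e split: if_splits)
  have m: "m < A i j" "m' < A i j" using assms e e' by (auto simp: edges_def)
  show ?thesis
  proof (cases "b i j")
    case True
    have "Im z = Im w" using im True M strip by (simp add: piece_def e e' strip_def)
    moreover have "(real m' + Re w) / real (A i j) = (real m + Re z) / real (A i j) - of_int l"
      using re True by (simp add: piece_def e e')
    then have "real m' + Re w = real m + Re z - of_int l * real (A i j)"
      using m by (simp add: field_simps)
    then have "Re w = Re z - of_int (l * int (A i j) + int m' - int m)" by simp
    moreover have "carry A b (l * int (A i j) + int m' - int m) e e' l"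
      using True by (simp add: carry_def e e')
    ultimately show ?thesis by blast
  next
    case False
    have mm: "m = m'" using False strip by (simp add: strip_def e e')
    have "1 / 4 \<le> Re (piece e z)" "Re (piece e z) \<le> 3 / 4" "1 / 4 \<le> Re (piece e' w)" "Re (piece e' w) \<le> 3 / 4"
      using piece_Re[OF assms(1)[unfolded e] assms(3) False] piece_Re[OF assms(2)[unfolded e'] assms(4) False]
      unfolding e e' by blast+
    then have "\<bar>of_int l\<bar> < (1::real)" using re by linarith
    then have l: "l = 0" by linarith
    have "piece e z = piece e' w" using im re l by (simp add: complex_eq_iff)
    then have "polar z = polar w" using False M by (simp add: piece_def e e' mm)
    then have "Im z = Im w \<and> (\<exists>k::int. Re w = Re z - of_int k)"
      using polar_eq_imp assms by blast
    \<comment> \<open>An edge without \<open>b\<close> multiplies the incoming exponent by 0, so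
      whichever \<open>k\<close> comes from \<open>polar\<close> is admissible.\<close>
    moreover have "carry A b k e e' l" for k using False by (simp add: carry_def e e' mm l)
    ultimately show ?thesis by blast
  qed
qed

section \<open>Points of left-infinite paths\<close>

text \<open>These are the paths along which the nested squares shrink to a point.\<close>

definition coded_paths :: "(nat \<Rightarrow> edge) set" where
  "coded_paths = {x \<in> infpaths N A. \<forall>T. \<exists>t\<ge>T. \<not> rigid (x t)}"

text \<open>The last edge \<open>x 0\<close> is outermost, so going outwards follows the direction
  in which a tail is read and carries travel.\<close>

fun nest :: "(nat \<Rightarrow> edge) \<Rightarrow> nat \<Rightarrow> complex \<Rightarrow> complex" where
  "nest x 0 z = z"
| "nest x (Suc n) z = nest x n (piece (x n) z)"

text \<open>\<open>\<kappa> (Suc s)\<close> is the exponent acting on the edge at position \<open>s\<close>, and \<open>\<kappa> s\<close> its restriction there;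
  the carry \<open>\<kappa> 0\<close> out of the last edge is discarded.\<close>

definition carries :: "(nat \<Rightarrow> int) \<Rightarrow> (nat \<Rightarrow> edge) \<Rightarrow> (nat \<Rightarrow> edge) \<Rightarrow> nat \<Rightarrow> bool" where
  "carries \<kappa> x y n \<longleftrightarrow> (\<forall>s<n. carry A b (\<kappa> (Suc s)) (x s) (y s) (\<kappa> s))"

definition point :: "(nat \<Rightarrow> edge) \<Rightarrow> complex" where
  "point x = lim (\<lambda>n. nest x n 0)"

text \<open>The final \<open>polar\<close> ignores the integer carry out of \<open>x 0\<close>, just
  as \<open>ae_rel\<close> discards the last restriction.\<close>

definition plane_code :: "(nat \<Rightarrow> edge) \<Rightarrow> complex" where
  "plane_code x = polar (point x)"

lemma carry_refl: "carry A b 0 e e 0"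
  by (cases e) (simp add: carry_def)

lemma nest_unit_square:
  "(\<And>t. x t \<in> edges N A) \<Longrightarrow> z \<in> unit_square \<Longrightarrow> nest x n z \<in> unit_square"
  by (induction n arbitrary: z) (auto intro: piece_unit_square)

lemma nest_add: "nest x (n + p) z = nest x n (nest (\<lambda>t. x (t + n)) p z)"
  by (induction p arbitrary: z) (simp_all add: add.commute)

lemma rate_nonneg: "0 \<le> rate e" and rate_le_1: "rate e \<le> 1"
  by (simp_all add: rate_def)

lemma nest_twist_dist:
  assumes "\<And>t. x t \<in> edges N A" "\<And>t. y t \<in> edges N A"
  shows "carries \<kappa> x y n \<Longrightarrow> z \<in> unit_square \<Longrightarrow> w \<in> unit_square \<Longrightarrow>
    twist_dist (nest x n z) (nest y n w) (\<kappa> 0) \<le> (\<Prod>s<n. rate (x s)) * twist_dist z w (\<kappa> n)"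
proof (induction n arbitrary: z w)
  case 0
  then show ?case by simp
next
  case (Suc n)
  have "carries \<kappa> x y n" "carry A b (\<kappa> (Suc n)) (x n) (y n) (\<kappa> n)"
    using Suc.prems(1) by (auto simp: carries_def)
  then have "twist_dist (piece (x n) z) (piece (y n) w) (\<kappa> n) \<le> rate (x n) * twist_dist z w (\<kappa> (Suc n))"
    using piece_twist_dist assms Suc.prems by blast
  moreover have "twist_dist (nest x n (piece (x n) z)) (nest y n (piece (y n) w)) (\<kappa> 0)
      \<le> (\<Prod>s<n. rate (x s)) * twist_dist (piece (x n) z) (piece (y n) w) (\<kappa> n)"
    using Suc.IH \<open>carries \<kappa> x y n\<close> piece_unit_square assms Suc.prems by blast
  moreover have "0 \<le> (\<Prod>s<n. rate (x s))" by (intro prod_nonneg) (simp add: rate_nonneg)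
  ultimately have "twist_dist (nest x n (piece (x n) z)) (nest y n (piece (y n) w)) (\<kappa> 0)
      \<le> (\<Prod>s<n. rate (x s)) * (rate (x n) * twist_dist z w (\<kappa> (Suc n)))"
    by (meson mult_left_mono order_trans)
  then show ?case by (simp add: mult.assoc)
qed

text \<open>No edge increases the product, and each of the infinitely many non-rigid edges halves
  it.\<close>

lemma rates_tendsto_0:
  assumes "x \<in> coded_paths"
  shows "(\<lambda>n. \<Prod>s<n. rate (x s)) \<longlonglongrightarrow> 0"
proof -
  let ?p = "\<lambda>n. \<Prod>s<n. rate (x s)"
  have nonneg: "0 \<le> ?p n" for n by (intro prod_nonneg) (simp add: rate_nonneg)
  have dec: "decseq ?p"
    using nonneg by (intro decseq_SucI) (simp add: mult_left_le rate_le_1)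
  have small: "\<exists>n. ?p n \<le> (1 / 2) ^ m" for m
  proof (induction m)
    case 0
    show ?case by (rule exI[of _ 0]) simp
  next
    case (Suc m)
    then obtain n where n: "?p n \<le> (1 / 2) ^ m" by blast
    obtain t where t: "n \<le> t" "\<not> rigid (x t)" using assms by (auto simp: coded_paths_def)
    then have "?p t \<le> (1 / 2) ^ m" using decseqD[OF dec t(1)] n by linarith
    then have "?p (Suc t) \<le> (1 / 2) ^ Suc m" using t(2) by (simp add: rate_def)
    then show ?case by blast
  qed
  show ?thesis
  proof (rule LIMSEQ_I)
    fix r :: real assume "0 < r"
    then obtain m where "(1 / 2 :: real) ^ m < r" using real_arch_pow_inv[of r "1 / 2"] by auto
    moreover obtain n0 where "?p n0 \<le> (1 / 2) ^ m" using small by blast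
    ultimately have "\<forall>n\<ge>n0. norm (?p n - 0) < r"
      using nonneg decseqD[OF dec] by (smt (verit) real_norm_def)
    then show "\<exists>n0. \<forall>n\<ge>n0. norm (?p n - 0) < r" by blast
  qed
qed

lemma coded_paths_edges: "x \<in> coded_paths \<Longrightarrow> x t \<in> edges N A"
  by (simp add: coded_paths_def infpaths_def)

lemma coded_paths_shift: "x \<in> coded_paths \<Longrightarrow> (\<lambda>t. x (t + n)) \<in> coded_paths"
proof -
  assume x: "x \<in> coded_paths"
  have "\<exists>t\<ge>T. \<not> rigid (x (t + n))" for T
  proof -
    obtain t where "T + n \<le> t" "\<not> rigid (x t)" using x by (auto simp: coded_paths_def)
    then show ?thesis by (intro exI[of _ "t - n"]) auto
  qed
  then show ?thesis using x by (auto simp: coded_paths_def infpaths_def)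
qed

lemma zero_unit_square: "0 \<in> unit_square"
  by (simp add: unit_square_def)

lemma coded_nest_unit_square:
  assumes "x \<in> coded_paths" "z \<in> unit_square"
  shows "nest x n z \<in> unit_square"
  by (rule nest_unit_square[OF coded_paths_edges[OF assms(1)] assms(2)])

lemma nest_prefix_dist:
  assumes "x \<in> coded_paths" "y \<in> coded_paths" "\<And>s. s < n \<Longrightarrow> y s = x s"
    and "z \<in> unit_square" "w \<in> unit_square"
  shows "twist_dist (nest x n z) (nest y n w) 0 \<le> (\<Prod>s<n. rate (x s)) * twist_dist z w 0"
proof -
  have "carries (\<lambda>_. 0) x y n" using assms(3) carry_refl by (simp add: carries_def)
  then show ?thesis
    by (rule nest_twist_dist[OF coded_paths_edges[OF assms(1)] coded_paths_edges[OF assms(2)] _ assms(4,5)])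
qed

text \<open>All later iterates lie in the image of the unit square under the first \<open>n0\<close>
  maps, whose diameter is at most twice the product of rates.\<close>

lemma nest_convergent:
  assumes "x \<in> coded_paths"
  shows "(\<lambda>n. nest x n 0) \<longlonglongrightarrow> point x"
proof -
  let ?p = "\<lambda>n. \<Prod>s<n. rate (x s)"
  have bound: "norm (nest x n 0 - nest x n0 0) \<le> ?p n0 * 2" if "n0 \<le> n" for n n0
  proof -
    let ?z = "nest (\<lambda>t. x (t + n0)) (n - n0) 0"
    have "?z \<in> unit_square"
      by (intro coded_nest_unit_square coded_paths_shift assms zero_unit_square)
    then have "twist_dist 0 ?z 0 \<le> 2"
      using twist_dist_unit_square[of 0 ?z 0] zero_unit_square by simp
    then have "?p n0 * twist_dist 0 ?z 0 \<le> ?p n0 * 2"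
      by (intro mult_left_mono prod_nonneg) (auto simp: rate_nonneg)
    moreover have "nest x n 0 = nest x n0 ?z" using nest_add[of x n0 "n - n0" 0] that by simp
    then have "twist_dist (nest x n0 0) (nest x n 0) 0 \<le> ?p n0 * twist_dist 0 ?z 0"
      by (simp only:) (rule nest_prefix_dist[OF assms assms refl zero_unit_square \<open>?z \<in> unit_square\<close>])
    ultimately show ?thesis using norm_le_twist_dist[of "nest x n 0" "nest x n0 0"] by linarith
  qed
  have "Cauchy (\<lambda>n. nest x n 0)"
  proof (rule CauchyI)
    fix r :: real assume "0 < r"
    then have "0 < r / 4" by simp
    from LIMSEQ_D[OF rates_tendsto_0[OF assms] this]
    obtain n0 where "norm (?p n0 - 0) < r / 4" by blast
    then have n0: "?p n0 * 2 < r / 2" by simp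
    have "norm (nest x m 0 - nest x n 0) < r" if "n0 \<le> m" "n0 \<le> n" for m n
      using bound[of n0 m] bound[of n0 n] n0 that
        norm_triangle_ineq4[of "nest x m 0 - nest x n0 0" "nest x n 0 - nest x n0 0"] by simp
    then show "\<exists>M. \<forall>m\<ge>M. \<forall>n\<ge>M. norm (nest x m 0 - nest x n 0) < r" by blast
  qed
  then show ?thesis
    unfolding point_def by (simp add: Cauchy_convergent_iff convergent_LIMSEQ_iff)
qed

lemma point_unit_square: "x \<in> coded_paths \<Longrightarrow> point x \<in> unit_square"
  by (rule closed_sequentially[OF closed_unit_square _ nest_convergent])
    (rule coded_nest_unit_square[OF _ zero_unit_square])

text \<open>The limit passes through \<open>nest x n\<close>, which is Lipschitz by
  \<open>nest_prefix_dist\<close> applied to \<open>x\<close> and itself.\<close>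

lemma point_nest:
  assumes "x \<in> coded_paths"
  shows "point x = nest x n (point (\<lambda>t. x (t + n)))"
proof -
  let ?y = "\<lambda>t. x (t + n)" and ?p = "\<Prod>s<n. rate (x s)"
  have y: "?y \<in> coded_paths" using coded_paths_shift assms by blast
  have sq: "point ?y \<in> unit_square" "nest ?y m 0 \<in> unit_square" for m
    by (rule point_unit_square[OF y], rule coded_nest_unit_square[OF y zero_unit_square])
  have bound: "norm (nest x n (nest ?y m 0) - nest x n (point ?y)) \<le> ?p * (2 * norm (nest ?y m 0 - point ?y))" for m
  proof -
    have "norm (nest x n (nest ?y m 0) - nest x n (point ?y)) \<le> ?p * twist_dist (point ?y) (nest ?y m 0) 0"
      by (rule order_trans[OF norm_le_twist_dist nest_prefix_dist[OF assms assms refl sq]])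
    also have "\<dots> \<le> ?p * (2 * norm (nest ?y m 0 - point ?y))"
      by (intro mult_left_mono twist_dist_le_norm prod_nonneg) (auto simp: rate_nonneg)
    finally show ?thesis .
  qed
  have "(\<lambda>m. ?p * (2 * norm (nest ?y m 0 - point ?y))) \<longlonglongrightarrow> 0"
    using nest_convergent[OF y] by (intro tendsto_mult_right_zero tendsto_norm_zero) (simp add: LIM_zero_iff)
  then have "(\<lambda>m. nest x n (nest ?y m 0) - nest x n (point ?y)) \<longlonglongrightarrow> 0"
    by (rule Lim_null_comparison[rotated]) (simp add: bound)
  then have "(\<lambda>m. nest x (n + m) 0) \<longlonglongrightarrow> nest x n (point ?y)"
    by (simp add: nest_add LIM_zero_iff)
  moreover have "(\<lambda>m. nest x (n + m) 0) \<longlonglongrightarrow> point x"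
    using LIMSEQ_ignore_initial_segment[OF nest_convergent[OF assms], of n] by (simp add: add.commute)
  ultimately show ?thesis using LIMSEQ_unique by blast
qed

text \<open>This is the modulus of continuity: 32 is the factor 16 of \<open>polar\<close> times the
  diameter 2 of the square.\<close>

lemma plane_code_prefix_dist:
  assumes "x \<in> coded_paths" "y \<in> coded_paths" "\<And>s. s < n \<Longrightarrow> y s = x s"
  shows "norm (plane_code y - plane_code x) \<le> 32 * (\<Prod>s<n. rate (x s))"
proof -
  let ?x = "point (\<lambda>t. x (t + n))" and ?y = "point (\<lambda>t. y (t + n))" and ?p = "\<Prod>s<n. rate (x s)"
  have sq: "?x \<in> unit_square" "?y \<in> unit_square"
    by (intro point_unit_square coded_paths_shift assms)+
  have "twist_dist (nest x n ?x) (nest y n ?y) 0 \<le> ?p * twist_dist ?x ?y 0"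
    by (rule nest_prefix_dist[OF assms sq])
  then have "twist_dist (point x) (point y) 0 \<le> ?p * twist_dist ?x ?y 0"
    by (simp only: point_nest[OF assms(1), symmetric] point_nest[OF assms(2), symmetric])
  also have "\<dots> \<le> ?p * 2"
    using twist_dist_unit_square[OF sq, of 0] by (intro mult_left_mono prod_nonneg) (auto simp: rate_nonneg)
  finally have "16 * twist_dist (point x) (point y) 0 \<le> 32 * ?p" by simp
  then show ?thesis unfolding plane_code_def
    using norm_polar_diff_le[of "point x" "point y" 0] point_unit_square assms(1,2) by fastforce
qed

text \<open>The carries may be chosen anew for each \<open>n\<close>; only the one entering at depth
  \<open>n\<close> is bounded uniformly. It adds at most \<open>C\<close> to the distance at that
  depth, which the product of rates sends to 0.\<close>

lemma plane_code_eqI: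
  assumes "x \<in> coded_paths" "y \<in> coded_paths"
    and carr: "\<And>n. \<exists>\<kappa>. \<bar>\<kappa> n\<bar> \<le> C \<and> carries \<kappa> x y n"
  shows "plane_code x = plane_code y"
proof -
  have bound: "norm (plane_code y - plane_code x) \<le> 16 * ((\<Prod>s<n. rate (x s)) * (2 + of_int C))" for n
  proof -
    let ?x = "point (\<lambda>t. x (t + n))" and ?y = "point (\<lambda>t. y (t + n))" and ?p = "\<Prod>s<n. rate (x s)"
    obtain \<kappa> where \<kappa>: "\<bar>\<kappa> n\<bar> \<le> C" "carries \<kappa> x y n" using carr by blast
    have sq: "?x \<in> unit_square" "?y \<in> unit_square"
      by (intro point_unit_square coded_paths_shift assms)+
    have "norm (plane_code y - plane_code x) \<le> 16 * twist_dist (point x) (point y) (\<kappa> 0)"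
      unfolding plane_code_def by (intro norm_polar_diff_le point_unit_square assms)
    also have "twist_dist (point x) (point y) (\<kappa> 0) = twist_dist (nest x n ?x) (nest y n ?y) (\<kappa> 0)"
      by (simp only: point_nest[OF assms(1), symmetric] point_nest[OF assms(2), symmetric])
    also have "\<dots> \<le> ?p * twist_dist ?x ?y (\<kappa> n)"
      by (rule nest_twist_dist[OF coded_paths_edges[OF assms(1)] coded_paths_edges[OF assms(2)] \<kappa>(2) sq])
    also have "\<dots> \<le> ?p * (2 + of_int C)"
      using twist_dist_unit_square[OF sq, of "\<kappa> n"] \<kappa>(1)
      by (intro mult_left_mono prod_nonneg) (auto simp: rate_nonneg)
    finally show ?thesis by simp
  qed
  have "(\<lambda>n. 16 * ((\<Prod>s<n. rate (x s)) * (2 + of_int C))) \<longlonglongrightarrow> 0"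
    by (intro tendsto_mult_right_zero tendsto_mult_left_zero rates_tendsto_0 assms)
  then have "norm (plane_code y - plane_code x) \<le> 0"
    by (rule LIMSEQ_le_const) (use bound in blast)
  then show ?thesis by simp
qed

text \<open>The outer \<open>polar\<close> yields the first integer difference of real parts, and
  \<open>piece_carry\<close> hands it inwards edge by edge. Real parts lie between 0 and 1, whence
  the bound 1.\<close>

lemma plane_code_eqD:
  assumes "x \<in> coded_paths" "y \<in> coded_paths" "plane_code x = plane_code y"
  shows "\<exists>\<kappa>. (\<forall>n. \<bar>\<kappa> n\<bar> \<le> 1) \<and> (\<forall>n. carries \<kappa> x y n)"
proof -
  let ?x = "\<lambda>n. point (\<lambda>t. x (t + n))" and ?y = "\<lambda>n. point (\<lambda>t. y (t + n))"
  \<comment> \<open>The difference turns out to be an integer in \<open>main\<close>; the floor only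
    reads it off.\<close>
  define \<kappa> where "\<kappa> n = \<lfloor>Re (?x n) - Re (?y n)\<rfloor>" for n
  have sq: "?x n \<in> unit_square" "?y n \<in> unit_square" for n
    by (intro point_unit_square coded_paths_shift assms)+
  have unfold_x: "?x n = piece (x n) (?x (Suc n))" for n
    using point_nest[OF coded_paths_shift[OF assms(1), of n], of 1] by (simp add: add.commute)
  have unfold_y: "?y n = piece (y n) (?y (Suc n))" for n
    using point_nest[OF coded_paths_shift[OF assms(2), of n], of 1] by (simp add: add.commute)
  have \<kappa>_eqI: "\<kappa> n = k" if "Re (?y n) = Re (?x n) - of_int k" for n k
    using that by (simp add: \<kappa>_def)
  have step: "Im (?x (Suc n)) = Im (?y (Suc n)) \<and> Re (?y (Suc n)) = Re (?x (Suc n)) - of_int (\<kappa> (Suc n))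
      \<and> carry A b (\<kappa> (Suc n)) (x n) (y n) (\<kappa> n)"
    if "Im (?x n) = Im (?y n)" "Re (?y n) = Re (?x n) - of_int (\<kappa> n)" for n
    using piece_carry[OF coded_paths_edges[OF assms(1), of n] coded_paths_edges[OF assms(2), of n]
        sq(1)[of "Suc n"] sq(2)[of "Suc n"], of "\<kappa> n"] that \<kappa>_eqI[of "Suc n"]
    unfolding unfold_x[of n, symmetric] unfold_y[of n, symmetric] by blast
  have main: "Im (?x n) = Im (?y n) \<and> Re (?y n) = Re (?x n) - of_int (\<kappa> n)" for n
  proof (induction n)
    case 0
    have "polar (?x 0) = polar (?y 0)" using assms(3) by (simp add: plane_code_def)
    then show ?case using polar_eq_imp[OF _ sq] \<kappa>_eqI by blast
  next
    case (Suc n)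
    then show ?case using step by blast
  qed
  have "\<bar>\<kappa> n\<bar> \<le> 1" for n
  proof -
    have "\<bar>of_int (\<kappa> n)\<bar> \<le> (1 :: real)" using main[of n] sq[of n] by (auto simp: unit_square_def)
    then show ?thesis by linarith
  qed
  then show ?thesis using step main unfolding carries_def by blast
qed

section \<open>Carries and the action on finite tails\<close>

lemma pact_carry:
  assumes "e' \<in> edges N A" "carry A b k e e' l"
  shows "pact A (\<lambda>i j. of_bool (b i j)) k (e # \<nu>) = e' # pact A (\<lambda>i j. of_bool (b i j)) l \<nu>"
proof -
  obtain i j m m' where e: "e = (i,j,m)" "e' = (i,j,m')"
    and k: "k * of_bool (b i j) + int m = l * int (A i j) + int m'"
    using assms(2) unfolding carry_def by blast
  have "m' < A i j" using assms(1) e by (simp add: edges_def)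
  then have "(k * of_bool (b i j) + int m) mod int (A i j) = int m'"
    "(k * of_bool (b i j) + int m) div int (A i j) = l"
    unfolding k by simp_all
  then show ?thesis by (simp add: e)
qed

lemma carry_pact:
  assumes "e \<in> edges N A"
    and "pact A (\<lambda>i j. of_bool (b i j)) k (e # \<nu>) = e' # \<nu>'"
  shows "\<exists>l. carry A b k e e' l \<and> pact A (\<lambda>i j. of_bool (b i j)) l \<nu> = \<nu>'"
proof -
  obtain i j m where e: "e = (i,j,m)" by (cases e)
  define n where "n = k * of_bool (b i j) + int m"
  have "0 < int (A i j)" using assms(1) e by (auto simp: edges_def)
  then have "n = (n div int (A i j)) * int (A i j) + int (nat (n mod int (A i j)))" by simp
  then have "carry A b k e (i, j, nat (n mod int (A i j))) (n div int (A i j))"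
    unfolding carry_def e n_def by blast
  then show ?thesis using assms(2) by (auto simp: e n_def)
qed

lemma tailp_Suc: "tailp x (Suc t) = x (Suc t) # tailp x t"
  by (simp add: tailp_def)

lemma tailp_0: "tailp x 0 = [x 0]"
  by (simp add: tailp_def)

lemma pact_tailp:
  assumes "\<And>t. y t \<in> edges N A"
  shows "carries \<kappa> x y (Suc t) \<Longrightarrow> pact A (\<lambda>i j. of_bool (b i j)) (\<kappa> (Suc t)) (tailp x t) = tailp y t"
proof (induction t)
  case 0
  then show ?case using pact_carry[OF assms] by (simp add: tailp_0 carries_def)
next
  case (Suc t)
  then have "carries \<kappa> x y (Suc t)" "carry A b (\<kappa> (Suc (Suc t))) (x (Suc t)) (y (Suc t)) (\<kappa> (Suc t))"
    by (auto simp: carries_def)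
  then show ?case using Suc.IH pact_carry[OF assms] by (simp add: tailp_Suc)
qed

lemma carries_tailp:
  assumes "\<And>t. x t \<in> edges N A"
  shows "pact A (\<lambda>i j. of_bool (b i j)) k (tailp x t) = tailp y t \<Longrightarrow> \<exists>\<kappa>. \<kappa> (Suc t) = k \<and> carries \<kappa> x y (Suc t)"
proof (induction t arbitrary: k)
  case 0
  then obtain l where "carry A b k (x 0) (y 0) l"
    using carry_pact[OF assms] unfolding tailp_0 by blast
  then show ?case by (intro exI[of _ "\<lambda>s. if s = 0 then l else k"]) (simp add: carries_def)
next
  case (Suc t)
  then obtain l where l: "carry A b k (x (Suc t)) (y (Suc t)) l"
    "pact A (\<lambda>i j. of_bool (b i j)) l (tailp x t) = tailp y t"
    using carry_pact[OF assms] unfolding tailp_Suc by blast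
  then obtain \<kappa> where "\<kappa> (Suc t) = l" "carries \<kappa> x y (Suc t)" using Suc.IH by blast
  then have "carries (\<kappa>(Suc (Suc t) := k)) x y (Suc (Suc t))"
    using l(1) by (auto simp: carries_def less_Suc_eq)
  then show ?case by (metis fun_upd_same)
qed

section \<open>Continuity of the code on left-infinite paths\<close>

lemma openin_plane_code_vimage:
  assumes coded: "coded_paths = infpaths N A" and "open V"
  shows "openin (inftop N A) {x \<in> infpaths N A. plane_code x \<in> V}"
proof (subst openin_subopen, intro ballI)
  fix x assume "x \<in> {x \<in> infpaths N A. plane_code x \<in> V}"
  then have x: "x \<in> infpaths N A" "plane_code x \<in> V" by auto
  obtain r where r: "0 < r" "ball (plane_code x) r \<subseteq> V" using x(2) assms(2) openE by blast
  have xc: "x \<in> coded_paths" using x coded by simp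
  have "0 < r / 32" using r by simp
  from LIMSEQ_D[OF rates_tendsto_0[OF xc] this]
  obtain n where "norm ((\<Prod>s<n. rate (x s)) - 0) < r / 32" by blast
  then have n: "32 * (\<Prod>s<n. rate (x s)) < r" by simp
  \<comment> \<open>A cylinder around \<open>x\<close>: only the first \<open>n\<close> coordinates
    are constrained, so it is open.\<close>
  define Y where "Y = (PiE UNIV (\<lambda>s. if s < n then {x s} else edges N A)) \<inter> infpaths N A"
  have "openin (product_topology (\<lambda>_. discrete_topology (edges N A)) UNIV)
      (PiE UNIV (\<lambda>s. if s < n then {x s} else edges N A))"
  proof (subst openin_PiE_gen, intro disjI2 conjI ballI)
    show "finite {s \<in> UNIV. (if s < n then {x s} else edges N A) \<noteq> topspace (discrete_topology (edges N A))}"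
      by (rule finite_subset[of _ "{..<n}"]) auto
  qed (use coded_paths_edges[OF xc] in auto)
  then have "openin (inftop N A) Y" unfolding inftop_def Y_def openin_subtopology by blast
  moreover have "x \<in> Y" using x coded_paths_edges[OF xc] by (auto simp: Y_def)
  moreover have "Y \<subseteq> {x \<in> infpaths N A. plane_code x \<in> V}"
  proof
    fix y assume y: "y \<in> Y"
    have "y s = x s" if "s < n" for s
      using y that by (auto simp: Y_def PiE_def Pi_def split: if_splits)
    then have "norm (plane_code y - plane_code x) < r"
      using plane_code_prefix_dist[OF xc, of y n] y coded n by (force simp: Y_def)
    then have "plane_code y \<in> V" using r(2) by (auto simp: dist_norm norm_minus_commute)
    then show "y \<in> {x \<in> infpaths N A. plane_code x \<in> V}" using y by (simp add: Y_def)
  qed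
  ultimately show "\<exists>U. openin (inftop N A) U \<and> x \<in> U \<and> U \<subseteq> {x \<in> infpaths N A. plane_code x \<in> V}"
    by blast
qed

end

section \<open>Finite paths and classes of the group bundle\<close>

lemma fpath_Cons:
  "fpath N A i (e # \<nu>) \<longleftrightarrow> e \<in> edges N A \<and> rng e = i \<and> fpath N A (src e) \<nu>"
proof
  assume f: "fpath N A i (e # \<nu>)"
  then have "src ((e # \<nu>) ! t) = rng ((e # \<nu>) ! Suc t)" if "t < length \<nu>" for t
    using that by (auto simp: fpath_def)
  from this[of 0] this[of "Suc _"] f
  show "e \<in> edges N A \<and> rng e = i \<and> fpath N A (src e) \<nu>"
    by (auto simp: fpath_def edges_def src_def hd_conv_nth)
next
  assume f: "e \<in> edges N A \<and> rng e = i \<and> fpath N A (src e) \<nu>"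
  have "src ((e # \<nu>) ! t) = rng ((e # \<nu>) ! Suc t)" if "t < length \<nu>" for t
    using f that by (cases t) (auto simp: fpath_def hd_conv_nth)
  then show "fpath N A i (e # \<nu>)"
    using f by (auto simp: fpath_def edges_def rng_def)
qed

lemma fpath_Nil: "fpath N A i [] \<longleftrightarrow> i \<in> {1..N}"
  by (simp add: fpath_def)

lemma fpath_edges: "fpath N A i \<mu> \<Longrightarrow> set \<mu> \<subseteq> edges N A"
  by (simp add: fpath_def)

lemma edge_src: "e \<in> edges N A \<Longrightarrow> src e \<in> {1..N}"
  and edge_rng: "e \<in> edges N A \<Longrightarrow> rng e \<in> {1..N}"
  by (auto simp: edges_def src_def rng_def)

lemma infpaths_segment:
  assumes "x \<in> infpaths N A" "s \<le> t"
  shows "fpath N A (rng (x t)) (rev (map x [s..<Suc t]))"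
  using assms(2)
proof (induction t rule: dec_induct)
  case base
  have "x s \<in> edges N A" using assms(1) by (simp add: infpaths_def)
  then show ?case using edge_src by (simp add: fpath_Cons fpath_Nil del: atLeastAtMost_iff)
next
  case (step t)
  have "src (x (Suc t)) = rng (x t)" "x (Suc t) \<in> edges N A"
    using assms(1) by (auto simp: infpaths_def)
  then show ?case using step by (simp add: fpath_Cons)
qed

lemma infpaths_tailp: "x \<in> infpaths N A \<Longrightarrow> fpath N A (rng (x t)) (tailp x t)"
  unfolding tailp_def by (rule infpaths_segment) simp_all

lemma pact_0: "set \<mu> \<subseteq> edges N A \<Longrightarrow> pact A B 0 \<mu> = \<mu>"
  by (induction \<mu>) (auto simp: edges_def)

text \<open>Adding \<open>l * B i j\<close> to the digit and then \<open>k * B i j\<close> to the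
  remainder gives the remainder for \<open>k + l\<close>, and the two quotients add up.\<close>

lemma pact_add:
  "set \<mu> \<subseteq> edges N A \<Longrightarrow> pact A B (k + l) \<mu> = pact A B k (pact A B l \<mu>)"
proof (induction \<mu> arbitrary: k l)
  case Nil
  then show ?case by simp
next
  case (Cons e \<nu>)
  obtain i j m where e: "e = (i,j,m)" by (cases e)
  define a q r where "a = int (A i j)" and "q = (l * B i j + int m) div a" and "r = (l * B i j + int m) mod a"
  have a: "0 < a" using Cons.prems by (auto simp: edges_def e a_def)
  then have r: "int (nat r) = r" by (simp add: r_def)
  have "l * B i j + int m = q * a + r" by (simp add: q_def r_def)
  then have "(k + l) * B i j + int m = (k * B i j + r) + q * a" by (simp add: algebra_simps)
  then have "((k + l) * B i j + int m) mod a = (k * B i j + r) mod a"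
    "((k + l) * B i j + int m) div a = (k * B i j + r) div a + q" using a by simp_all
  moreover have "pact A B ((k * B i j + r) div a + q) \<nu> = pact A B ((k * B i j + r) div a) (pact A B q \<nu>)"
    using Cons by simp
  ultimately show ?case
    using r by (simp add: e flip: a_def q_def r_def)
qed

text \<open>Classes act through a chosen representative; it has the same vertex, and its exponent
  differs by one that acts trivially.\<close>

lemma gcls_rep:
  assumes "i \<in> {1..N}"
  obtains k' where "(SOME p. p \<in> gcls N A B (i,k)) = (i,k')"
    and "\<And>\<mu>. fpath N A i \<mu> \<Longrightarrow> pact A B (k - k') \<mu> = \<mu>"
    and "\<And>\<mu>. fpath N A i \<mu> \<Longrightarrow> pact A B k' \<mu> = pact A B k \<mu>"
proof -
  have "(i,k) \<in> gcls N A B (i,k)"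
    using assms pact_0 fpath_edges by (fastforce simp: gcls_def kerrel_def)
  then have "(SOME p. p \<in> gcls N A B (i,k)) \<in> gcls N A B (i,k)" by (rule someI)
  then obtain k' where k': "(SOME p. p \<in> gcls N A B (i,k)) = (i,k')"
    and triv: "\<And>\<mu>. fpath N A i \<mu> \<Longrightarrow> pact A B (k - k') \<mu> = \<mu>"
    by (auto simp: gcls_def kerrel_def)
  have "pact A B k' \<mu> = pact A B k \<mu>" if "fpath N A i \<mu>" for \<mu>
    using pact_add[OF fpath_edges[OF that], of B k' "k - k'"] triv[OF that] by simp
  then show thesis using that k' triv by blast
qed

lemma gcls_in_GB: "i \<in> {1..N} \<Longrightarrow> gcls N A B (i,k) \<in> GB N A B"
  unfolding GB_def gcls_def by (rule quotientI) (simp add: zbundle_def)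

lemma gdom_gcls: "i \<in> {1..N} \<Longrightarrow> gdom (gcls N A B (i,k)) = i"
  by (rule gcls_rep[of i N A B k]) (simp_all add: gdom_def)

lemma gact_gcls: "fpath N A i \<mu> \<Longrightarrow> gact A B (gcls N A B (i,k)) \<mu> = pact A B k \<mu>"
  by (rule gcls_rep[of i N A B k]) (auto simp: gact_def fpath_def)

section \<open>Inert vertices and the consequence of regularity\<close>

text \<open>On an edge with inert range the action is trivial, so replacing its entry of \<open>B\<close> by \<open>0\<close>
  does not change the action. After this replacement regularity rules out infinite runs of edges
  with \<open>A i j = B i j = 1\<close>, the only edges along which the plane construction does not contract.\<close>

definition inert :: "nat \<Rightarrow> (nat \<Rightarrow> nat \<Rightarrow> nat) \<Rightarrow> (nat \<Rightarrow> nat \<Rightarrow> int) \<Rightarrow> nat \<Rightarrow> bool" where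
  "inert N A B i \<longleftrightarrow> (\<forall>k \<mu>. fpath N A i \<mu> \<longrightarrow> pact A B k \<mu> = \<mu>)"

definition moving :: "nat \<Rightarrow> (nat \<Rightarrow> nat \<Rightarrow> nat) \<Rightarrow> (nat \<Rightarrow> nat \<Rightarrow> int) \<Rightarrow> nat \<Rightarrow> nat \<Rightarrow> bool" where
  "moving N A B i j \<longleftrightarrow> B i j = 1 \<and> \<not> inert N A B i"

text \<open>From the first inert range on, the modified action passes exponent 0 and fixes the rest,
  as the original action does by inertness. Before that the entries agree.\<close>

lemma pact_moving:
  assumes "\<forall>i\<in>{1..N}. \<forall>j\<in>{1..N}. B i j \<in> {0, 1}"
  shows "fpath N A i \<mu> \<Longrightarrow> pact A (\<lambda>i j. of_bool (moving N A B i j)) k \<mu> = pact A B k \<mu>"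
proof (induction \<mu> arbitrary: i k)
  case Nil
  then show ?case by simp
next
  case (Cons e \<nu>)
  obtain j m where e: "e = (i,j,m)" using Cons.prems by (cases e) (auto simp: fpath_Cons rng_def)
  have edge: "(i,j,m) \<in> edges N A" and \<nu>: "fpath N A j \<nu>"
    using Cons.prems by (auto simp: fpath_Cons e src_def)
  show ?case
  proof (cases "inert N A B i")
    case True
    then have "pact A B k (e # \<nu>) = e # \<nu>" using Cons.prems by (simp add: inert_def)
    moreover have "pact A (\<lambda>i j. of_bool (moving N A B i j)) k (e # \<nu>) = e # \<nu>"
      using True edge pact_0[OF fpath_edges[OF \<nu>]] by (simp add: e moving_def edges_def)
    ultimately show ?thesis by simp
  next
    case False
    have "B i j \<in> {0, 1}" using assms edge by (auto simp: edges_def)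
    then have "of_bool (moving N A B i j) = B i j" using False by (auto simp: moving_def)
    then show ?thesis using Cons.IH[OF \<nu>] by (simp add: e)
  qed
qed

text \<open>The only digit is 0, and division by 1 hands the whole exponent on.\<close>

lemma rigid_fixed:
  assumes "\<forall>e\<in>set \<mu>. e \<in> edges N A \<and> B (rng e) (src e) = 1 \<and> A (rng e) (src e) = 1"
  shows "pact A B k \<mu> = \<mu> \<and> prestr A B k \<mu> = k"
  using assms by (induction \<mu>) (auto simp: edges_def rng_def src_def)

text \<open>In an endless rigid run some vertex \<open>v\<close> recurs. Long closed paths at
  \<open>v\<close> are fixed by every exponent and restrict it to itself, so regularity makes every
  class at \<open>v\<close> a unit. Then \<open>v\<close> is inert, whereas rigid edges have
  non-inert range.\<close>

lemma regular_not_eventually_rigid: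
  assumes reg: "regular N A B" and x: "x \<in> infpaths N A"
  shows "\<exists>t\<ge>T. \<not> (moving N A B (rng (x t)) (src (x t)) \<and> A (rng (x t)) (src (x t)) = 1)"
proof (rule ccontr)
  assume "\<not> ?thesis"
  then have rigid: "B (rng (x t)) (src (x t)) = 1" "A (rng (x t)) (src (x t)) = 1" "\<not> inert N A B (rng (x t))"
    if "T \<le> t" for t using that by (auto simp: moving_def)
  have edge: "x t \<in> edges N A" for t using x by (simp add: infpaths_def)
  have "finite (range (\<lambda>t. rng (x t)))"
    by (rule finite_subset[of _ "{1..N}"]) (use edge edge_rng in blast, simp)
  then obtain t0 where "infinite {t. rng (x t) = rng (x t0)}"
    using pigeonhole_infinite[of UNIV "\<lambda>t. rng (x t)"] by auto
  then obtain v where v: "\<And>s. \<exists>t\<ge>s. rng (x t) = v"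
    unfolding infinite_nat_iff_unbounded_le by blast
  obtain t1 where t1: "T \<le> t1" "rng (x t1) = v" using v by blast
  have vN: "v \<in> {1..N}" using edge_rng edge t1 by blast
  have "inert N A B v"
    unfolding inert_def
  proof (intro allI impI)
    fix k \<mu> assume \<mu>: "fpath N A v \<mu>"
    let ?g = "gcls N A B (v,k)"
    obtain k' where k': "(SOME p. p \<in> ?g) = (v,k')"
      and triv: "\<And>\<mu>. fpath N A v \<mu> \<Longrightarrow> pact A B k' \<mu> = pact A B k \<mu>"
      using gcls_rep[OF vN] by metis
    obtain K where K: "\<And>\<mu>. fpath N A v \<mu> \<Longrightarrow> gact A B ?g \<mu> = \<mu> \<Longrightarrow> K \<le> length \<mu> \<Longrightarrow>
        grestr N A B ?g \<mu> = gunit N A B (psrc v \<mu>)"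
      using reg gcls_in_GB[OF vN] gdom_gcls[OF vN] unfolding regular_def by metis
    obtain t2 where t2: "Suc t1 + K \<le> t2" "rng (x t2) = v" using v by blast
    \<comment> \<open>Starting at \<open>Suc t1\<close> closes the path, because the source of
      \<open>x (Suc t1)\<close> is the range \<open>v\<close> of \<open>x t1\<close>.\<close>
    define \<nu> where "\<nu> = rev (map x [Suc t1..<Suc t2])"
    have \<nu>: "fpath N A v \<nu>" "K \<le> length \<nu>"
      using infpaths_segment[OF x, of "Suc t1" t2] t2 by (simp_all add: \<nu>_def)
    have fixed: "pact A B l \<nu> = \<nu>" "prestr A B l \<nu> = l" for l
      using rigid_fixed[of \<nu> N A B l] rigid edge t1 by (auto simp: \<nu>_def)
    have "[Suc t1..<Suc t2] = Suc t1 # [Suc (Suc t1)..<Suc t2]" using t2 by (intro upt_conv_Cons) simp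
    then have "\<nu> \<noteq> []" "last \<nu> = x (Suc t1)" by (simp_all only: \<nu>_def) simp_all
    then have src: "psrc v \<nu> = v" using x t1 by (auto simp: psrc_def infpaths_def)
    have "gcls N A B (v,k') = gcls N A B (v,0)"
      using K[OF \<nu>(1) _ \<nu>(2)] fixed src by (simp add: gact_def grestr_def gunit_def gdom_gcls[OF vN] k')
    moreover have "(v,0) \<in> gcls N A B (v,0)"
      using vN pact_0 fpath_edges by (fastforce simp: gcls_def kerrel_def)
    ultimately have "(v,0) \<in> gcls N A B (v,k')" by simp
    then have "pact A B k' \<mu> = \<mu>" using \<mu> by (simp add: gcls_def kerrel_def)
    then show "pact A B k \<mu> = \<mu>" using triv \<mu> by simp
  qed
  then show False using rigid t1 by blast
qed

section \<open>The limit space and the induced map to the plane\<close>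

lemma finite_edges: "finite (edges N A)"
proof (rule finite_subset)
  show "edges N A \<subseteq> (\<Union>i\<in>{1..N}. \<Union>j\<in>{1..N}. (\<lambda>m. (i,j,m)) ` {..<A i j})"
    unfolding edges_def by blast
qed auto

text \<open>Preimages commute with unions and intersections, so the predicate passed to
  \<open>topology\<close> is indeed a topology.\<close>

lemma openin_limit_top:
  "openin (limit_top N A B) U \<longleftrightarrow> U \<subseteq> limit_space N A B \<and>
     openin (inftop N A) {x \<in> infpaths N A. ae_rel N A B `` {x} \<in> U}"
proof -
  let ?pre = "\<lambda>U. {x \<in> infpaths N A. ae_rel N A B `` {x} \<in> U}"
  let ?L = "\<lambda>U. U \<subseteq> limit_space N A B \<and> openin (inftop N A) (?pre U)"
  have inter: "?pre (S \<inter> T) = ?pre S \<inter> ?pre T" for S T by auto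
  have union: "?pre (\<Union>\<K>) = (\<Union>S\<in>\<K>. ?pre S)" for \<K> by auto
  have "istopology ?L"
    unfolding istopology_def inter union by (auto intro!: openin_Union)
  then show ?thesis unfolding limit_top_def by (simp add: topology_inverse')
qed

text \<open>Finiteness of \<open>F\<close> bounds the exponents of its chosen
  representatives.\<close>

lemma ae_rel_imp_bounded:
  assumes "(x,y) \<in> ae_rel N A B"
  shows "\<exists>C. \<forall>t. \<exists>k. \<bar>k\<bar> \<le> C \<and> pact A B k (tailp x t) = tailp y t"
proof -
  obtain F g where F: "finite F" "\<And>t. g t \<in> F" "\<And>t. gact A B (g t) (tailp x t) = tailp y t"
    using assms by (auto simp: ae_rel_def)
  define C where "C = Max ((\<lambda>h. \<bar>snd (SOME p. p \<in> h)\<bar>) ` F)"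
  have "\<bar>snd (SOME p. p \<in> g t)\<bar> \<le> C" for t
    unfolding C_def using F by (intro Max_ge) auto
  then show ?thesis using F(3) unfolding gact_def by blast
qed

text \<open>Finitely many vertices and exponents between \<open>-C\<close> and \<open>C\<close> give
  finitely many classes.\<close>

lemma bounded_imp_ae_rel:
  assumes "x \<in> infpaths N A" "y \<in> infpaths N A"
    and "\<And>t. \<bar>\<kappa> t\<bar> \<le> C" "\<And>t. pact A B (\<kappa> t) (tailp x t) = tailp y t"
  shows "(x,y) \<in> ae_rel N A B"
proof -
  define F where "F = gcls N A B ` ({1..N} \<times> {-C..C})"
  define g where "g t = gcls N A B (rng (x t), \<kappa> t)" for t
  have rng: "rng (x t) \<in> {1..N}" for t
    by (rule edge_rng[of _ N A]) (use assms(1) in \<open>simp add: infpaths_def\<close>)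
  have "F \<subseteq> GB N A B" "finite F" by (auto simp: F_def intro!: gcls_in_GB)
  moreover have "g t \<in> F" for t
    using rng[of t] assms(3)[of t] by (auto simp: F_def g_def abs_le_iff intro!: imageI)
  moreover have "gdom (g t) = rng (x t)" for t
    unfolding g_def by (rule gdom_gcls[OF rng])
  moreover have "gact A B (g t) (tailp x t) = tailp y t" for t
    unfolding g_def using gact_gcls[OF infpaths_tailp[OF assms(1)]] assms(4) by simp
  ultimately show ?thesis using assms(1,2) unfolding ae_rel_def by blast
qed

theorem theorem7p1:
  fixes N :: nat and A :: "nat \<Rightarrow> nat \<Rightarrow> nat" and B :: "nat \<Rightarrow> nat \<Rightarrow> int"
  assumes "katsura_pair N A B"
    and "\<forall>i\<in>{1..N}. \<forall>j\<in>{1..N}. B i j \<in> {0, 1}"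
    and "regular N A B"
  shows "\<exists>\<zeta> :: (nat \<Rightarrow> edge) set \<Rightarrow> complex.
           continuous_map (limit_top N A B) euclidean \<zeta> \<and> inj_on \<zeta> (limit_space N A B)"
proof -
  let ?R = "ae_rel N A B" and ?X = "infpaths N A"
  obtain c :: "edge \<Rightarrow> nat" and M where "c ` edges N A = {i. i < M}" "inj_on c (edges N A)"
    using finite_imp_inj_to_nat_seg[OF finite_edges] by metis
  then interpret edge_coding N A "moving N A B" c M by unfold_locales auto
  have "rigid e \<longleftrightarrow> moving N A B (rng e) (src e) \<and> A (rng e) (src e) = 1" for e
    by (cases e) (simp add: rigid_def rng_def src_def)
  then have coded: "coded_paths = ?X"
    using regular_not_eventually_rigid[OF assms(3)] unfolding coded_paths_def by auto
  \<comment> \<open>On paths the relation is the kernel of \<open>plane_code\<close>; this also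
    supplies its reflexivity and transitivity below.\<close>
  have ae_iff: "(x,y) \<in> ?R \<longleftrightarrow> plane_code x = plane_code y" if xy: "x \<in> ?X" "y \<in> ?X" for x y
  proof
    have edge: "\<And>t. x t \<in> edges N A" "\<And>t. y t \<in> edges N A" using xy by (simp_all add: infpaths_def)
    have pact: "pact A (\<lambda>i j. of_bool (moving N A B i j)) k (tailp x t) = pact A B k (tailp x t)" for k t
      by (rule pact_moving[OF assms(2) infpaths_tailp[OF xy(1)]])
    {
      assume "(x,y) \<in> ?R"
      then obtain C where C: "\<And>t. \<exists>k. \<bar>k\<bar> \<le> C \<and> pact A B k (tailp x t) = tailp y t"
        using ae_rel_imp_bounded by blast
      show "plane_code x = plane_code y"
      proof (rule plane_code_eqI)
        \<comment> \<open>The 0 in \<open>max C 0\<close> serves \<open>n = 0\<close>, where the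
          zero carries are taken.\<close>
        show "\<exists>\<kappa>. \<bar>\<kappa> n\<bar> \<le> max C 0 \<and> carries \<kappa> x y n" for n
        proof (cases n)
          case 0
          then show ?thesis by (intro exI[of _ "\<lambda>_. 0"]) (simp add: carries_def)
        next
          case (Suc t)
          obtain k where k: "\<bar>k\<bar> \<le> C" "pact A B k (tailp x t) = tailp y t" using C by blast
          obtain \<kappa> where "\<kappa> (Suc t) = k" "carries \<kappa> x y (Suc t)"
            using carries_tailp[of x k t y, OF edge(1)] pact k(2) by auto
          then show ?thesis using Suc k(1) by (intro exI[of _ \<kappa>]) simp
        qed
      qed (use xy coded in auto)
    next
      assume "plane_code x = plane_code y"
      then obtain \<kappa> where \<kappa>: "\<And>n. \<bar>\<kappa> n\<bar> \<le> 1" "\<And>n. carries \<kappa> x y n"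
        using plane_code_eqD[of x y] xy unfolding coded by blast
      show "(x,y) \<in> ?R"
      proof (rule bounded_imp_ae_rel[OF xy])
        show "\<bar>\<kappa> (Suc t)\<bar> \<le> 1" for t by (rule \<kappa>)
        show "pact A B (\<kappa> (Suc t)) (tailp x t) = tailp y t" for t
          using pact_tailp[of y \<kappa> x t, OF edge(2) \<kappa>(2)] unfolding pact .
      qed
    }
  qed
  have R_sub: "?R \<subseteq> ?X \<times> ?X" by (auto simp: ae_rel_def)
  define \<zeta> where "\<zeta> P = plane_code (SOME x. x \<in> P)" for P
  have \<zeta>: "\<zeta> (?R `` {x}) = plane_code x" if "x \<in> ?X" for x
  proof -
    have "x \<in> ?R `` {x}" using ae_iff that by blast
    then have "(SOME y. y \<in> ?R `` {x}) \<in> ?R `` {x}" by (rule someI[of "\<lambda>y. y \<in> ?R `` {x}"])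
    then have "(x, SOME y. y \<in> ?R `` {x}) \<in> ?R" by blast
    then show ?thesis unfolding \<zeta>_def using ae_iff[OF that] R_sub by auto
  qed
  have cls: "\<exists>x\<in>?X. P = ?R `` {x}" if "P \<in> limit_space N A B" for P
    using that unfolding limit_space_def by (auto elim: quotientE)
  have "inj_on \<zeta> (limit_space N A B)"
  proof (rule inj_onI)
    fix P Q assume "P \<in> limit_space N A B" "Q \<in> limit_space N A B" "\<zeta> P = \<zeta> Q"
    then obtain x y where xy: "x \<in> ?X" "P = ?R `` {x}" "y \<in> ?X" "Q = ?R `` {y}" "plane_code x = plane_code y"
      using cls[of P] cls[of Q] \<zeta> by auto
    have "(x,z) \<in> ?R \<longleftrightarrow> (y,z) \<in> ?R" for z
      using ae_iff[OF xy(1), of z] ae_iff[OF xy(3), of z] xy(5) R_sub by auto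
    then show "P = Q" unfolding xy by blast
  qed
  moreover have "continuous_map (limit_top N A B) euclidean \<zeta>"
    unfolding continuous_map
  proof (intro conjI allI impI)
    fix V :: "complex set" assume "openin euclidean V"
    have top: "topspace (limit_top N A B) = limit_space N A B"
    proof -
      \<comment> \<open>The preimage of the whole limit space is \<open>?X\<close>, written through
        \<open>plane_code\<close> so that its openness follows from the continuity lemma.\<close>
      have "{x \<in> ?X. ?R `` {x} \<in> limit_space N A B} = {x \<in> ?X. plane_code x \<in> UNIV}"
        unfolding limit_space_def by (auto intro: quotientI)
      then have "openin (limit_top N A B) (limit_space N A B)"
        using openin_plane_code_vimage[OF coded open_UNIV] by (simp add: openin_limit_top)
      then show ?thesis unfolding topspace_def using openin_limit_top by blast
    qed
    have pre: "{x \<in> ?X. ?R `` {x} \<in> {P \<in> limit_space N A B. \<zeta> P \<in> V}} = {x \<in> ?X. plane_code x \<in> V}"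
      using \<zeta> unfolding limit_space_def by (auto intro: quotientI)
    have "open V" using \<open>openin euclidean V\<close> by (simp only: open_openin)
    then show "openin (limit_top N A B) {P \<in> topspace (limit_top N A B). \<zeta> P \<in> V}"
      unfolding top openin_limit_top pre using openin_plane_code_vimage[OF coded] by blast
  qed simp
  ultimately show ?thesis by blast
qed

end
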